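(* Let $0<\alpha<1$, $\kappa>0$, $T>0$, let $M\ge1$ be an integer, $\tau=T/M$, and let $u^0=g\in L^2(\Omega)$. Let $u^1,\dots,u^M\in H_0^1(\Omega)$ be the solutions of the homogeneous ($S=0$) semidiscrete weak scheme described in the context. Then the scheme is unconditionally stable, in the sense that (with no restriction on $\tau$) $$\|u^k\|_1\le\|u^0\|,\qquad k=1,\dots,M.$$
   Context: $\Omega=(0,1)^2$; $(u,v)=\int_\Omega uv\,d\Omega$ and $\|\cdot\|$ is the $L^2(\Omega)$ norm. Put $\mu=\frac{1}{\tau^\alpha\Gamma(2-\alpha)}$, $\alpha_0=\kappa/\mu$, and $b_j=(j+1)^{1-\alpha}-j^{1-\alpha}$ for $j\ge0$. The energy inner product and norm on $H_0^1(\Omega)$ are $(u,v)_1=(u,v)+\alpha_0(\nabla u,\nabla v)$, $\|u\|_1=(u,u)_1^{1/2}$. Semidiscrete weak scheme with $S=0$ (L1 time discretization of $D_t^\alpha u=\kappa\Delta u$, $u=0$ on $\partial\Omega$, $u(\cdot,0)=g$, with $D_t^\alpha$ the Caputo derivative): $u^0=g$, and $u^{k+1}\in H_0^1(\Omega)$ satisfies for all $v\in H_0^1(\Omega)$ $$(u^{1},v)+\alpha_0(\nabla u^{1},\nabla v)=(u^0,v)\qquad (k=0),$$ $$(u^{k+1},v)+\alpha_0(\nabla u^{k+1},\nabla v)=\Big((1-b_1)u^k+\sum_{j=1}^{k-1}(b_j-b_{j+1})u^{k-j}+b_ku^0,\ v\Big)\qquad(1\le k\le M-1).$$ *)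

theory Defs
  imports "HOL-Analysis.Analysis"
begin

text \<open>
  Elements of the Lebesgue and Sobolev spaces are represented by functions on the whole
  space of which only the values on \<open>S\<close>, up to null sets, matter.
\<close>

definition L2_space :: "'a::euclidean_space set \<Rightarrow> ('a \<Rightarrow> 'b::euclidean_space) set" where
  "L2_space S = {u. u \<in> borel_measurable (lebesgue_on S) \<and>
                    integrable (lebesgue_on S) (\<lambda>x. (norm (u x))\<^sup>2)}"

definition L2_inner :: "'a::euclidean_space set \<Rightarrow> ('a \<Rightarrow> 'b::euclidean_space) \<Rightarrow> ('a \<Rightarrow> 'b) \<Rightarrow> real" where
  "L2_inner S u v = (LINT x|lebesgue_on S. u x \<bullet> v x)"

definition L2_norm :: "'a::euclidean_space set \<Rightarrow> ('a \<Rightarrow> 'b::euclidean_space) \<Rightarrow> real" where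
  "L2_norm S u = sqrt (L2_inner S u u)"

definition partial_deriv :: "'a::euclidean_space \<Rightarrow> ('a \<Rightarrow> real) \<Rightarrow> 'a \<Rightarrow> real" where
  "partial_deriv i f = (\<lambda>x. frechet_derivative f (at x) i)"

primrec C_order :: "nat \<Rightarrow> ('a::euclidean_space \<Rightarrow> real) \<Rightarrow> bool" where
  "C_order 0 f \<longleftrightarrow> continuous_on UNIV f"
| "C_order (Suc n) f \<longleftrightarrow>
     (\<forall>x. f differentiable (at x)) \<and> (\<forall>i\<in>Basis. C_order n (partial_deriv i f))"

definition test_functions :: "'a::euclidean_space set \<Rightarrow> ('a \<Rightarrow> real) set" where
  "test_functions S = {\<phi>. (\<forall>n. C_order n \<phi>) \<and>
      compact (closure {x. \<phi> x \<noteq> 0}) \<and> closure {x. \<phi> x \<noteq> 0} \<subseteq> S}"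

definition is_weak_grad ::
    "'a::euclidean_space set \<Rightarrow> ('a \<Rightarrow> real) \<Rightarrow> ('a \<Rightarrow> 'a) \<Rightarrow> bool" where
  "is_weak_grad S u G \<longleftrightarrow> (\<forall>\<phi>\<in>test_functions S. \<forall>i\<in>Basis.
     (LINT x|lebesgue_on S. u x * partial_deriv i \<phi> x) = - (LINT x|lebesgue_on S. (G x \<bullet> i) * \<phi> x))"

definition H1_space :: "'a::euclidean_space set \<Rightarrow> ('a \<Rightarrow> real) set" where
  "H1_space S = {u \<in> L2_space S. \<exists>G\<in>L2_space S. is_weak_grad S u G}"

text \<open>For \<open>u \<in> H1_space S\<close> with \<open>S\<close> open, the weak gradient in \<open>L2_space S\<close> exists and is
  unique almost everywhere on \<open>S\<close>, so integrals do not depend on the choice below.\<close>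

definition weak_grad :: "'a::euclidean_space set \<Rightarrow> ('a \<Rightarrow> real) \<Rightarrow> 'a \<Rightarrow> 'a" where
  "weak_grad S u = (SOME G. G \<in> L2_space S \<and> is_weak_grad S u G)"

definition H1_norm :: "'a::euclidean_space set \<Rightarrow> ('a \<Rightarrow> real) \<Rightarrow> real" where
  "H1_norm S u = sqrt ((L2_norm S u)\<^sup>2 + (L2_norm S (weak_grad S u))\<^sup>2)"

definition H10_space :: "'a::euclidean_space set \<Rightarrow> ('a \<Rightarrow> real) set" where
  "H10_space S = {u \<in> H1_space S. \<exists>\<phi>. (\<forall>n::nat. \<phi> n \<in> test_functions S) \<and>
      (\<lambda>n. H1_norm S (\<lambda>x. u x - \<phi> n x)) \<longlonglongrightarrow> 0}"

definition energy_inner ::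
    "'a::euclidean_space set \<Rightarrow> real \<Rightarrow> ('a \<Rightarrow> real) \<Rightarrow> ('a \<Rightarrow> real) \<Rightarrow> real" where
  "energy_inner S a u v = L2_inner S u v + a * L2_inner S (weak_grad S u) (weak_grad S v)"

definition energy_norm :: "'a::euclidean_space set \<Rightarrow> real \<Rightarrow> ('a \<Rightarrow> real) \<Rightarrow> real" where
  "energy_norm S a u = sqrt (energy_inner S a u u)"

definition unit_square :: "(real^2) set" where
  "unit_square = {x. \<forall>i. 0 < x $ i \<and> x $ i < 1}"

definition L1_mu :: "real \<Rightarrow> real \<Rightarrow> real" where
  "L1_mu \<alpha> \<tau> = 1 / (\<tau> powr \<alpha> * Gamma (2 - \<alpha>))"

definition L1_coeff :: "real \<Rightarrow> nat \<Rightarrow> real" where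
  "L1_coeff \<alpha> j = real (j + 1) powr (1 - \<alpha>) - real j powr (1 - \<alpha>)"

definition L1_scheme_solution ::
    "real \<Rightarrow> real \<Rightarrow> real \<Rightarrow> nat \<Rightarrow> (real^2 \<Rightarrow> real) \<Rightarrow> (nat \<Rightarrow> real^2 \<Rightarrow> real) \<Rightarrow> bool" where
  "L1_scheme_solution \<alpha> \<kappa> \<tau> M g u \<longleftrightarrow>
     (let \<Omega> = unit_square; \<alpha>\<^sub>0 = \<kappa> / L1_mu \<alpha> \<tau>; b = L1_coeff \<alpha> in
       u 0 = g \<and>
       (\<forall>k\<in>{1..M}. u k \<in> H10_space \<Omega>) \<and>
       (\<forall>v\<in>H10_space \<Omega>.
          L2_inner \<Omega> (u 1) v + \<alpha>\<^sub>0 * L2_inner \<Omega> (weak_grad \<Omega> (u 1)) (weak_grad \<Omega> v)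
            = L2_inner \<Omega> (u 0) v) \<and>
       (\<forall>k. 1 \<le> k \<and> k + 1 \<le> M \<longrightarrow> (\<forall>v\<in>H10_space \<Omega>.
          L2_inner \<Omega> (u (k + 1)) v
            + \<alpha>\<^sub>0 * L2_inner \<Omega> (weak_grad \<Omega> (u (k + 1))) (weak_grad \<Omega> v)
          = L2_inner \<Omega> (\<lambda>x. (1 - b 1) * u k x
              + (\<Sum>j = 1..k - 1. (b j - b (j + 1)) * u (k - j) x) + b k * u 0 x) v)))"

end

theory Submission
  imports Defs
begin

text \<open>
  Since \<open>b\<^sub>0 = 1\<close> and \<open>b\<close> is decreasing and nonnegative, the right-hand side of the scheme is the
  convex combination of the previous iterates \<open>u\<^sup>k, \<dots>, u\<^sup>0\<close>. Testing with \<open>v = u\<^sup>k\<^sup>+\<^sup>1\<close>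
  and estimating each term by \<open>(w, v) \<le> (\<parallel>w\<parallel>\<^sup>2 + \<parallel>v\<parallel>\<^sup>2) / 2\<close> gives, by strong induction,
  \<open>\<parallel>v\<parallel>\<^sub>1\<^sup>2 \<le> (\<parallel>u\<^sup>0\<parallel>\<^sup>2 + \<parallel>v\<parallel>\<^sub>1\<^sup>2) / 2\<close>.
\<close>

lemma L2_inner_nonneg: "0 \<le> L2_inner S u u"
  unfolding L2_inner_def by (rule Bochner_Integration.integral_nonneg) simp

lemma L2_inner_le_energy_inner: "0 \<le> a \<Longrightarrow> L2_inner S u u \<le> energy_inner S a u u"
  by (simp add: energy_inner_def L2_inner_nonneg)

lemma H10_space_subset_L2_space: "H10_space S \<subseteq> L2_space S"
  by (auto simp: H10_space_def H1_space_def)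

text \<open>The product is dominated by the sum of the squares. Splitting or comparing
  \<open>L2_inner\<close> terms rests on this, as the integral of a non-integrable function defaults
  to 0.\<close>

lemma integrable_L2_space_mult:
  fixes u v :: "'a::euclidean_space \<Rightarrow> real"
  assumes "u \<in> L2_space S" "v \<in> L2_space S"
  shows "integrable (lebesgue_on S) (\<lambda>x. u x * v x)"
proof (rule Bochner_Integration.integrable_bound)
  show "integrable (lebesgue_on S) (\<lambda>x. (norm (u x))\<^sup>2 + (norm (v x))\<^sup>2)"
    using assms by (intro Bochner_Integration.integrable_add) (auto simp: L2_space_def)
  show "(\<lambda>x. u x * v x) \<in> borel_measurable (lebesgue_on S)"
    using assms by (auto simp: L2_space_def intro: borel_measurable_times)
  have "norm (u x * v x) \<le> norm ((norm (u x))\<^sup>2 + (norm (v x))\<^sup>2)" for x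
  proof -
    have "2 * (\<bar>u x\<bar> * \<bar>v x\<bar>) \<le> (u x)\<^sup>2 + (v x)\<^sup>2"
      using sum_squares_bound[of "\<bar>u x\<bar>" "\<bar>v x\<bar>"] by simp
    moreover have "0 \<le> \<bar>u x\<bar> * \<bar>v x\<bar>"
      by simp
    ultimately have "\<bar>u x\<bar> * \<bar>v x\<bar> \<le> (u x)\<^sup>2 + (v x)\<^sup>2"
      by linarith
    then show ?thesis
      by (simp add: abs_mult)
  qed
  then show "AE x in lebesgue_on S. norm (u x * v x) \<le> norm ((norm (u x))\<^sup>2 + (norm (v x))\<^sup>2)"
    by simp
qed

lemma L2_inner_le_half:
  fixes u v :: "'a::euclidean_space \<Rightarrow> real"
  assumes "u \<in> L2_space S" "v \<in> L2_space S"
  shows "L2_inner S u v \<le> (L2_inner S u u + L2_inner S v v) / 2"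
proof -
  have "L2_inner S u v \<le> (LINT x|lebesgue_on S. (u x * u x + v x * v x) / 2)"
    unfolding L2_inner_def
  proof (rule integral_mono)
    fix x
    show "u x \<bullet> v x \<le> (u x * u x + v x * v x) / 2"
      using sum_squares_bound[of "u x" "v x"] by (simp add: power2_eq_square)
  qed (use assms in \<open>auto intro!: integrable_L2_space_mult\<close>)
  also have "\<dots> = (L2_inner S u u + L2_inner S v v) / 2"
    using assms by (simp add: L2_inner_def integrable_L2_space_mult)
  finally show ?thesis .
qed

lemma L2_inner_sum_left:
  fixes v :: "'a::euclidean_space \<Rightarrow> real"
  assumes "\<And>i. i \<in> I \<Longrightarrow> f i \<in> L2_space S" "v \<in> L2_space S"
  shows "L2_inner S (\<lambda>x. \<Sum>i\<in>I. c i * f i x) v = (\<Sum>i\<in>I. c i * L2_inner S (f i) v)"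
  using assms
  by (simp add: L2_inner_def sum_distrib_right mult.assoc integrable_L2_space_mult
      Bochner_Integration.integral_sum)

text \<open>Each \<open>L2_inner S (f i) v\<close> has the same bound, so averaging with weights of
  sum 1 preserves it. In the scheme, \<open>f i\<close> runs over the earlier iterates and
  \<open>v\<close> is the new one.\<close>

lemma L2_inner_convex_combination_le:
  fixes v :: "'a::euclidean_space \<Rightarrow> real"
  assumes "\<And>i. i \<in> I \<Longrightarrow> f i \<in> L2_space S" "v \<in> L2_space S"
    and "\<And>i. i \<in> I \<Longrightarrow> 0 \<le> c i" "sum c I = 1"
    and "\<And>i. i \<in> I \<Longrightarrow> L2_inner S (f i) (f i) \<le> B"
  shows "L2_inner S (\<lambda>x. \<Sum>i\<in>I. c i * f i x) v \<le> (B + L2_inner S v v) / 2"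
proof -
  have "L2_inner S (f i) v \<le> (B + L2_inner S v v) / 2" if "i \<in> I" for i
    using L2_inner_le_half[of "f i" S v] assms(1,2,5) that by fastforce
  then have "(\<Sum>i\<in>I. c i * L2_inner S (f i) v) \<le> (\<Sum>i\<in>I. c i * ((B + L2_inner S v v) / 2))"
    by (intro sum_mono mult_left_mono assms(3))
  also have "\<dots> = (B + L2_inner S v v) / 2"
    using assms(4) by (simp only: sum_distrib_right[symmetric] mult_1)
  finally show ?thesis
    by (simp only: L2_inner_sum_left[OF assms(1,2)])
qed

text \<open>Young's inequality is the tangent-line bound for \<open>z powr p\<close> at the midpoint
  \<open>m\<close>, scaled by \<open>m powr (1 - p)\<close>. Adding it at \<open>x\<close> and
  \<open>y\<close> cancels the linear terms.\<close>

lemma powr_midpoint_concave: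
  fixes x y p :: real
  assumes "0 \<le> x" "0 \<le> y" "0 < x + y" "0 < p" "p < 1"
  shows "x powr p + y powr p \<le> 2 * ((x + y) / 2) powr p"
proof -
  define m where "m = (x + y) / 2"
  have m: "m > 0" and xy: "x + y = 2 * m"
    using assms by (auto simp: m_def)
  have young: "z powr p * m powr (1 - p) \<le> p * z + (1 - p) * m" if "0 \<le> z" for z
  proof (cases "z = 0")
    case False
    then show ?thesis
      using assms m that by (intro Youngs_inequality_0) auto
  qed (use assms m in simp)
  have "(x powr p + y powr p) * m powr (1 - p) \<le> (p * x + (1 - p) * m) + (p * y + (1 - p) * m)"
    unfolding distrib_right
    by (intro add_mono young assms)
  also have "\<dots> = p * (x + y) + 2 * (1 - p) * m"
    by (simp add: algebra_simps)
  also have "\<dots> = 2 * m"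
    unfolding xy by (simp add: algebra_simps)
  also have "\<dots> = 2 * m powr p * m powr (1 - p)"
    using m by (simp add: powr_add[symmetric])
  finally show ?thesis
    using m by (simp add: m_def)
qed

lemma L1_coeff_0: "L1_coeff \<alpha> 0 = 1"
  by (simp add: L1_coeff_def)

lemma L1_coeff_nonneg: "\<alpha> < 1 \<Longrightarrow> 0 \<le> L1_coeff \<alpha> j"
  by (simp add: L1_coeff_def powr_mono2)

text \<open>This is midpoint concavity at \<open>j\<close> and \<open>j + 2\<close>, whose midpoint
  is \<open>j + 1\<close>; for \<open>j = 0\<close> one endpoint is 0.\<close>

lemma L1_coeff_Suc_le:
  assumes "0 < \<alpha>" "\<alpha> < 1"
  shows "L1_coeff \<alpha> (Suc j) \<le> L1_coeff \<alpha> j"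
  using powr_midpoint_concave[of "real j" "real (j + 2)" "1 - \<alpha>"] assms
  by (simp add: L1_coeff_def add_divide_distrib algebra_simps)

theorem theorem1:
  fixes \<alpha> \<kappa> T \<tau> :: real and M :: nat
    and g :: "real^2 \<Rightarrow> real" and u :: "nat \<Rightarrow> real^2 \<Rightarrow> real"
  assumes "0 < \<alpha>" and "\<alpha> < 1" and "\<kappa> > 0" and "T > 0" and "M \<ge> 1"
    and "\<tau> = T / real M"
    and "g \<in> L2_space unit_square"
    and "L1_scheme_solution \<alpha> \<kappa> \<tau> M g u"
  shows "\<forall>k\<in>{1..M}. energy_norm unit_square (\<kappa> / L1_mu \<alpha> \<tau>) (u k) \<le> L2_norm unit_square (u 0)"
proof -
  define a where "a = \<kappa> / L1_mu \<alpha> \<tau>"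
  define b where "b = L1_coeff \<alpha>"
  let ?S = "unit_square"
  let ?B = "L2_inner ?S (u 0) (u 0)"
  have "0 < Gamma (2 - \<alpha>)"
    using assms by (intro Gamma_real_pos) auto
  then have a: "0 \<le> a"
    using assms by (simp add: a_def L1_mu_def)
  note scheme = assms(8)[unfolded L1_scheme_solution_def Let_def, folded a_def b_def]
  have H10: "u k \<in> H10_space ?S" if "1 \<le> k" "k \<le> M" for k
    using scheme that by auto
  have L2: "u k \<in> L2_space ?S" if "k \<le> M" for k
  proof (cases "k = 0")
    case True
    with scheme assms(7) show ?thesis
      by simp
  next
    case False
    with that show ?thesis
      using H10[of k] H10_space_subset_L2_space by auto
  qed
  have first: "energy_inner ?S a (u 1) (u 1) = L2_inner ?S (u 0) (u 1)"
    using scheme H10[of 1] assms(5) by (auto simp: energy_inner_def)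
  have energy: "energy_inner ?S a (u (Suc k)) (u (Suc k)) \<le> ?B"
    if "Suc k \<le> M" for k
    using that
  proof (induction k rule: less_induct)
    case (less k)
    \<comment> \<open>Weight of \<open>u (k - j)\<close> in the scheme: the weight
      \<open>b k\<close> of \<open>u 0\<close> is the case \<open>j = k\<close>, and
      \<open>1 - b 1\<close> is the case \<open>j = 0 < k\<close> because \<open>b 0 = 1\<close>.
      For \<open>k = 0\<close> the only weight is 1, as in the first step of the scheme.\<close>
    define c where "c j = b j - (if j = k then 0 else b (Suc j))" for j
    define w where "w = (\<lambda>x. \<Sum>j\<le>k. c j * u (k - j) x)"
    have c_nonneg: "0 \<le> c j" for j
      using L1_coeff_nonneg L1_coeff_Suc_le assms(1,2) by (simp add: c_def b_def)
    have c_sum: "sum c {..k} = 1"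
    proof -
      have "sum c {..k} = (\<Sum>j<k. b j - b (Suc j)) + b k"
        by (simp add: lessThan_Suc_atMost[symmetric] c_def)
      also have "\<dots> = b 0"
        by (simp add: sum_lessThan_telescope')
      finally show ?thesis
        by (simp add: b_def L1_coeff_0)
    qed
    \<comment> \<open>For \<open>j < k\<close> the induction hypothesis bounds the energy, which
      dominates the L2 part; for \<open>j = k\<close> the iterate is \<open>u 0\<close>
      itself.\<close>
    have bound: "L2_inner ?S (u (k - j)) (u (k - j)) \<le> ?B" if "j \<le> k" for j
    proof (cases "j = k")
      case False
      with that obtain i where i: "k - j = Suc i" "i < k"
        by (cases "k - j") auto
      then have "energy_inner ?S a (u (Suc i)) (u (Suc i)) \<le> ?B"
        using less by simp
      then show ?thesis
        unfolding i(1) by (rule order_trans[OF L2_inner_le_energy_inner[OF a]])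
    qed simp
    have "energy_inner ?S a (u (Suc k)) (u (Suc k)) = L2_inner ?S w (u (Suc k))"
    proof (cases "k = 0")
      case True
      then show ?thesis
        using first by (simp add: w_def c_def b_def L1_coeff_0)
    next
      case False
      have w_eq: "w = (\<lambda>x. (1 - b 1) * u k x + (\<Sum>j = 1..k - 1. (b j - b (j + 1)) * u (k - j) x)
        + b k * u 0 x)"
      proof
        fix x
        have "w x = (\<Sum>j<k. (b j - b (Suc j)) * u (k - j) x) + b k * u 0 x"
          by (simp add: w_def lessThan_Suc_atMost[symmetric] c_def)
        \<comment> \<open>The scheme writes the term \<open>j = 0\<close> separately; for
          \<open>k = 1\<close> the remaining range is empty.\<close>
        also have "{..<k} = insert 0 {1..k - 1}"
          using False by auto
        finally show "w x = (1 - b 1) * u k x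
          + (\<Sum>j = 1..k - 1. (b j - b (j + 1)) * u (k - j) x) + b k * u 0 x"
          by (simp add: b_def L1_coeff_0)
      qed
      have "1 \<le> k" "k + 1 \<le> M"
        using False less.prems by auto
      then show ?thesis
        using scheme H10[of "k + 1"] unfolding w_eq energy_inner_def Suc_eq_plus1 by simp
    qed
    also have "\<dots> \<le> (?B + L2_inner ?S (u (Suc k)) (u (Suc k))) / 2"
      unfolding w_def
      by (rule L2_inner_convex_combination_le)
        (use L2 less.prems c_nonneg c_sum bound in auto)
    \<comment> \<open>The L2 term on the right is at most the energy on the left, so half of the
      energy is absorbed.\<close>
    finally show ?case
      using L2_inner_le_energy_inner[OF a, of ?S "u (Suc k)"] by simp
  qed
  show ?thesis
  proof
    fix k assume "k \<in> {1..M}"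
    then show "energy_norm ?S (\<kappa> / L1_mu \<alpha> \<tau>) (u k) \<le> L2_norm ?S (u 0)"
      using energy[of "k - 1"] by (simp add: energy_norm_def L2_norm_def a_def)
  qed
qed

end
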